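(* Let $u\in\mathcal{M}$ be a balanced word. Then $\phi(u)=\phi(\omega(u))$ and $u\overset{\mathrm{bal}}{\sim}\omega(u)$.
   Context: $\Bbbk$ is a field of characteristic $0$. $\mathcal{M}$ is the free monoid on two letters $D,U$. $\mathcal{W}=\Bbbk\langle D,U\mid DU-UD=1\rangle$ is the Weyl algebra and $\phi:\mathcal{M}\to\mathcal{W}$ is the monoid morphism with $D\mapsto D$, $U\mapsto U$. A word is balanced if it has equally many $D$'s and $U$'s. $\omega:\mathcal{M}\to\mathcal{M}$ is the monoid anti-morphism with $\omega(U)=D,\ \omega(D)=U$ (reverse the word and swap each letter). A balanced commutation turns $pyxq$ into $pxyq$ for words $p,q$ and balanced words $x,y$; $\overset{\mathrm{bal}}{\sim}$ is the equivalence relation generated by (finite sequences of) balanced commutations. *)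

theory Defs
  imports "HOL-Library.Poly_Mapping" "HOL-Computational_Algebra.Polynomial"
begin

datatype letter = D | U

type_synonym word = "letter list"

text \<open>Lists form a monoid under concatenation, written additively because the convolution
  product of \<^theory>\<open>HOL-Library.Poly_Mapping\<close> expects an additive monoid of exponents.  With it,
  the type of finitely supported maps from words to a field \<open>'k\<close> is the free associative
  \<open>'k\<close>-algebra on \<open>D\<close> and \<open>U\<close>.\<close>

instantiation list :: (type) monoid_add
begin

definition zero_list :: "'a list" where "zero_list = []"

definition plus_list :: "'a list \<Rightarrow> 'a list \<Rightarrow> 'a list" where "plus_list xs ys = xs @ ys"

instance
  by standard (simp_all add: zero_list_def plus_list_def)

end

type_synonym 'k free_algebra = "word \<Rightarrow>\<^sub>0 'k"

definition free_gen :: "letter \<Rightarrow> 'k::field_char_0 free_algebra"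
  where "free_gen a = Poly_Mapping.single [a] 1"

text \<open>The two-sided ideal generated by \<open>DU - UD - 1\<close>.\<close>

inductive_set weyl_ideal :: "'k::field_char_0 free_algebra set"
  where
    zero: "0 \<in> weyl_ideal"
  | gen: "p * (free_gen D * free_gen U - free_gen U * free_gen D - 1) * q \<in> weyl_ideal"
  | add: "f \<in> weyl_ideal \<Longrightarrow> g \<in> weyl_ideal \<Longrightarrow> f + g \<in> weyl_ideal"

lemma weyl_ideal_mult_left: "f \<in> weyl_ideal \<Longrightarrow> h * f \<in> weyl_ideal"
proof (induction rule: weyl_ideal.induct)
  case (gen p q)
  show ?case
    using weyl_ideal.gen[of "h * p" q] by (simp only: mult.assoc)
qed (auto simp: distrib_left intro: weyl_ideal.zero weyl_ideal.add)

lemma weyl_ideal_mult_right: "f \<in> weyl_ideal \<Longrightarrow> f * h \<in> weyl_ideal"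
proof (induction rule: weyl_ideal.induct)
  case (gen p q)
  show ?case
    using weyl_ideal.gen[of p "q * h"] by (simp only: mult.assoc)
qed (auto simp: distrib_right intro: weyl_ideal.zero weyl_ideal.add)

lemma weyl_ideal_uminus: "f \<in> weyl_ideal \<Longrightarrow> - f \<in> weyl_ideal"
  using weyl_ideal_mult_left[of f "- 1"] by simp

text \<open>To see that the ideal is proper (so that the quotient satisfies \<open>0 \<noteq> 1\<close>), let the free algebra act
  on polynomials: \<open>D\<close> as derivative, \<open>U\<close> as multiplication by the variable.\<close>

primrec letter_act :: "letter \<Rightarrow> 'k::field_char_0 poly \<Rightarrow> 'k poly"
  where
    "letter_act D s = pderiv s"
  | "letter_act U s = pCons 0 s"

definition word_act :: "word \<Rightarrow> 'k::field_char_0 poly \<Rightarrow> 'k poly"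
  where "word_act w s = foldr letter_act w s"

definition free_act :: "'k::field_char_0 free_algebra \<Rightarrow> 'k poly \<Rightarrow> 'k poly"
  where "free_act f s = (\<Sum>w\<in>Poly_Mapping.keys f. smult (Poly_Mapping.lookup f w) (word_act w s))"

lemma letter_act_add: "letter_act a (s + t) = letter_act a s + letter_act a t"
  by (cases a) (simp_all add: pderiv_add)

lemma letter_act_smult: "letter_act a (smult c s) = smult c (letter_act a s)"
  by (cases a) (simp_all add: pderiv_smult)

lemma word_act_add: "word_act w (s + t) = word_act w s + word_act w t"
  by (induction w) (simp_all add: word_act_def letter_act_add)

lemma word_act_smult: "word_act w (smult c s) = smult c (word_act w s)"
  by (induction w) (simp_all add: word_act_def letter_act_smult)

lemma word_act_append: "word_act (v + w) s = word_act v (word_act w s)"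
  by (simp add: word_act_def plus_list_def)

lemma free_act_zero: "free_act 0 s = 0"
  by (simp add: free_act_def)

lemma free_act_single: "free_act (Poly_Mapping.single w c) s = smult c (word_act w s)"
  by (simp add: free_act_def)

lemma free_act_superset:
  assumes "finite A" "Poly_Mapping.keys f \<subseteq> A"
  shows "free_act f s = (\<Sum>w\<in>A. smult (Poly_Mapping.lookup f w) (word_act w s))"
  unfolding free_act_def
  by (rule sum.mono_neutral_left) (use assms in \<open>auto simp: in_keys_iff\<close>)

lemma free_act_add: "free_act (f + g) s = free_act f s + free_act g s"
proof -
  let ?A = "Poly_Mapping.keys f \<union> Poly_Mapping.keys g"
  have "Poly_Mapping.keys (f + g) \<subseteq> ?A"
    by (rule Poly_Mapping.keys_add)
  then show ?thesis
    by (simp add: free_act_superset[of ?A] lookup_add smult_add_left sum.distrib)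
qed

lemma free_act_diff: "free_act (f - g) s = free_act f s - free_act g s"
  using free_act_add[of "f - g" g s] by (simp add: algebra_simps)

lemma free_act_add_right: "free_act f (s + t) = free_act f s + free_act f t"
  by (simp add: free_act_def word_act_add smult_add_right sum.distrib)

lemma free_act_zero_right: "free_act f 0 = 0"
  using free_act_add_right[of f 0 0] by simp

lemma free_algebra_induct [case_names single add]:
  fixes f :: "'k::field_char_0 free_algebra"
  assumes single: "\<And>w c. P (Poly_Mapping.single w c)"
    and add: "\<And>f g. P f \<Longrightarrow> P g \<Longrightarrow> P (f + g)"
  shows "P f"
proof (induction f rule: update_induct)
  case const
  show ?case using single[of "[]" 0] by simp
next
  case (update f a b)
  have "Poly_Mapping.update a b f = Poly_Mapping.single a b + f"
    using update(1)
    by (intro poly_mapping_eqI)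
      (auto simp: lookup_update lookup_add lookup_single when_def in_keys_iff)
  then show ?case using add[OF single update(3)] by simp
qed

lemma free_act_mult: "free_act (f * g) s = free_act f (free_act g s)"
proof (induction f rule: free_algebra_induct)
  case (single v c)
  show ?case
  proof (induction g rule: free_algebra_induct)
    case (single w d)
    show ?case
      by (simp add: mult_single free_act_single word_act_append word_act_smult)
  next
    case (add g h)
    then show ?case
      by (simp add: distrib_left free_act_add free_act_add_right)
  qed
next
  case (add f h)
  then show ?case
    by (simp add: distrib_right free_act_add)
qed

lemma free_act_weyl_ideal: "f \<in> weyl_ideal \<Longrightarrow> free_act f s = 0"
proof (induction arbitrary: s rule: weyl_ideal.induct)
  case (gen p q)
  have "free_act (free_gen D * free_gen U - free_gen U * free_gen D - 1) t = 0" for t :: "'a poly"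
    by (simp add: free_act_diff free_act_mult free_gen_def free_act_single word_act_def
        pderiv_pCons flip: single_one) (simp add: free_act_single zero_list_def)
  then show ?case
    by (simp add: free_act_mult free_act_zero_right)
qed (simp_all add: free_act_zero free_act_add)

lemma one_notin_weyl_ideal: "1 \<notin> weyl_ideal"
proof
  assume "1 \<in> (weyl_ideal :: 'a free_algebra set)"
  then have "free_act (1 :: 'a free_algebra) 1 = 0"
    by (rule free_act_weyl_ideal)
  then show False
    by (simp add: free_act_single zero_list_def word_act_def flip: single_one)
qed

definition weyl_rel :: "'k::field_char_0 free_algebra \<Rightarrow> 'k free_algebra \<Rightarrow> bool"
  where "weyl_rel f g \<longleftrightarrow> f - g \<in> weyl_ideal"

lemma equivp_weyl_rel: "equivp weyl_rel"
proof (intro equivpI reflpI sympI transpI)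
  fix f g h :: "'a free_algebra"
  show "weyl_rel f f"
    by (simp add: weyl_rel_def weyl_ideal.zero)
  show "weyl_rel g f" if "weyl_rel f g"
    using weyl_ideal_uminus[of "f - g"] that by (simp add: weyl_rel_def)
  show "weyl_rel f h" if "weyl_rel f g" "weyl_rel g h"
    using weyl_ideal.add[of "f - g" "g - h"] that by (simp add: weyl_rel_def)
qed

quotient_type (overloaded) 'k weyl = "'k::field_char_0 free_algebra" / weyl_rel
  by (rule equivp_weyl_rel)

instantiation weyl :: (field_char_0) ring_1
begin

lift_definition zero_weyl :: "'a weyl" is 0 .

lift_definition one_weyl :: "'a weyl" is 1 .

lift_definition plus_weyl :: "'a weyl \<Rightarrow> 'a weyl \<Rightarrow> 'a weyl" is "(+)"
  by (simp only: weyl_rel_def add_diff_add weyl_ideal.add)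

lift_definition uminus_weyl :: "'a weyl \<Rightarrow> 'a weyl" is uminus
  by (simp only: weyl_rel_def minus_diff_minus weyl_ideal_uminus)

lift_definition minus_weyl :: "'a weyl \<Rightarrow> 'a weyl \<Rightarrow> 'a weyl" is "(-)"
proof -
  fix f f' g g' :: "'a free_algebra"
  assume "weyl_rel f f'" "weyl_rel g g'"
  then have "(f - f') + - (g - g') \<in> weyl_ideal"
    unfolding weyl_rel_def by (intro weyl_ideal.add weyl_ideal_uminus)
  then show "weyl_rel (f - g) (f' - g')"
    unfolding weyl_rel_def by (simp add: algebra_simps)
qed

lift_definition times_weyl :: "'a weyl \<Rightarrow> 'a weyl \<Rightarrow> 'a weyl" is "(*)"
proof -
  fix f f' g g' :: "'a free_algebra"
  assume "weyl_rel f f'" "weyl_rel g g'"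
  then have "(f - f') * g + f' * (g - g') \<in> weyl_ideal"
    unfolding weyl_rel_def
    by (intro weyl_ideal.add weyl_ideal_mult_left weyl_ideal_mult_right)
  then show "weyl_rel (f * g) (f' * g')"
    unfolding weyl_rel_def by (simp add: algebra_simps)
qed

instance
proof
  show "(0::'a weyl) \<noteq> 1"
  proof (transfer, rule notI)
    assume "weyl_rel (0 :: 'a free_algebra) 1"
    then show False
      using weyl_ideal_uminus[of "0 - 1 :: 'a free_algebra"] one_notin_weyl_ideal[where 'a='a]
      by (simp add: weyl_rel_def)
  qed
qed (transfer, simp add: algebra_simps equivp_reflp[OF equivp_weyl_rel])+

end

lift_definition weyl_gen :: "letter \<Rightarrow> 'k::field_char_0 weyl" is free_gen .

lemma weyl_relation: "weyl_gen D * weyl_gen U - weyl_gen U * weyl_gen D = (1 :: 'k::field_char_0 weyl)"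
  by transfer (use weyl_ideal.gen[of 1 1] in \<open>simp add: weyl_rel_def\<close>)

definition phi :: "word \<Rightarrow> 'k::field_char_0 weyl"
  where "phi w = prod_list (map weyl_gen w)"

definition balanced :: "word \<Rightarrow> bool"
  where "balanced w \<longleftrightarrow> count_list w D = count_list w U"

primrec swap_letter :: "letter \<Rightarrow> letter"
  where
    "swap_letter D = U"
  | "swap_letter U = D"

definition omega :: "word \<Rightarrow> word"
  where "omega w = rev (map swap_letter w)"

inductive bal_comm :: "word \<Rightarrow> word \<Rightarrow> bool"
  where "balanced x \<Longrightarrow> balanced y \<Longrightarrow> bal_comm (p @ y @ x @ q) (p @ x @ y @ q)"

definition bal_equiv :: "word \<Rightarrow> word \<Rightarrow> bool"
  where "bal_equiv = equivclp bal_comm"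

end

theory Submission
  imports Defs
begin

text \<open>Balanced words are generated from the empty word by concatenation and by the wrappings
  \<open>v \<mapsto> D v U\<close> and \<open>v \<mapsto> U v D\<close>: if the first and last letters of a balanced word agree, then the
  height function of its prefixes changes sign, so some proper nonempty prefix is balanced.
  Since \<open>\<omega> (D v U) = D (\<omega> v) U\<close>, and \<open>\<omega> (x y) = (\<omega> y) (\<omega> x)\<close> differs from \<open>(\<omega> x) (\<omega> y)\<close> by a balanced
  commutation, induction along these constructions gives the equivalence of \<open>u\<close> and \<open>\<omega> u\<close>.
  The same induction shows that \<open>\<phi>\<close> sends balanced words to polynomials in \<open>N = U D\<close>, because
  \<open>D N = (N + 1) D\<close> and \<open>U N = (N - 1) U\<close>; so images of balanced words commute, and \<open>\<phi>\<close> is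
  invariant under balanced commutations.\<close>

section \<open>Height function and structural induction on balanced words\<close>

text \<open>The letter counted positively is a parameter, so that a word starting and ending with
  \<open>a\<close> is treated once, whichever letter \<open>a\<close> is.\<close>

definition excess :: "letter \<Rightarrow> word \<Rightarrow> int"
  where "excess a w = int (count_list w a) - int (count_list w (swap_letter a))"

lemma excess_Nil [simp]: "excess a [] = 0"
  by (simp add: excess_def)

lemma excess_append [simp]: "excess a (v @ w) = excess a v + excess a w"
  by (simp add: excess_def)

lemma excess_Cons [simp]: "excess a (b # w) = (if a = b then 1 else - 1) + excess a w"
  by (cases a; cases b) (simp_all add: excess_def)

lemma balanced_iff_excess: "balanced w \<longleftrightarrow> excess a w = 0"
  by (cases a) (auto simp: balanced_def excess_def)

lemma balanced_Nil [simp]: "balanced []"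
  by (simp add: balanced_def)

lemma balanced_wrap:
  assumes "a \<noteq> b"
  shows "balanced (a # v @ [b]) \<longleftrightarrow> balanced v"
  using assms by (simp add: balanced_iff_excess[of _ a])

lemma balanced_split:
  assumes "balanced (a # w @ [a])"
  obtains x y where "a # w @ [a] = x @ y" "x \<noteq> []" "y \<noteq> []" "balanced x" "balanced y"
proof -
  let ?u = "a # w @ [a]"
  \<comment> \<open>The sign is flipped so that \<open>?f\<close> goes from -1 at index 1 to 1 at
    index \<open>length w + 1\<close>, as the discrete intermediate value theorem expects.\<close>
  let ?f = "\<lambda>i. - excess a (take i ?u)"
  have w: "excess a w = - 2"
    using assms by (simp add: balanced_iff_excess[of _ a])
  \<comment> \<open>\<open>?u\<close> has length \<open>length w + 2\<close>, so these bounds leave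
    both the prefix and the remaining suffix nonempty.\<close>
  have "\<exists>i. 1 \<le> i \<and> i \<le> length w + 1 \<and> ?f i = 0"
  proof (rule nat_intermed_int_val)
    show "\<forall>i. 1 \<le> i \<and> i < length w + 1 \<longrightarrow> \<bar>?f (Suc i) - ?f i\<bar> \<le> 1"
    proof (intro allI impI)
      fix i
      assume "1 \<le> i \<and> i < length w + 1"
      then have "take (Suc i) ?u = take i ?u @ [?u ! i]"
        by (intro take_Suc_conv_app_nth) simp
      then show "\<bar>?f (Suc i) - ?f i\<bar> \<le> 1"
        by (simp del: take_Suc_Cons)
    qed
  qed (simp_all add: w)
  then obtain i where i: "1 \<le> i" "i \<le> length w + 1" "?f i = 0"
    by blast
  have x: "balanced (take i ?u)"
    using i(3) by (simp only: balanced_iff_excess[of _ a])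
  moreover have "excess a ?u = excess a (take i ?u) + excess a (drop i ?u)"
    by (metis append_take_drop_id excess_append)
  ultimately have "balanced (drop i ?u)"
    using assms by (simp only: balanced_iff_excess[of _ a])
  with x i show thesis
    by (intro that[of "take i ?u" "drop i ?u"]) auto
qed

lemma balanced_induct [consumes 1, case_names Nil append wrap]:
  assumes "balanced u"
    and Nil: "P []"
    and append: "\<And>x y. balanced x \<Longrightarrow> balanced y \<Longrightarrow> P x \<Longrightarrow> P y \<Longrightarrow> P (x @ y)"
    and wrap: "\<And>a b v. a \<noteq> b \<Longrightarrow> balanced v \<Longrightarrow> P v \<Longrightarrow> P (a # v @ [b])"
  shows "P u"
  using assms(1)
proof (induction u rule: length_induct)
  case (1 u)
  consider "u = []" | a where "u = [a]" | a b w where "u = a # w @ [b]"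
    by (metis append_butlast_last_id list.exhaust)
  then show ?case
  proof cases
    case 1
    then show ?thesis using Nil by simp
  next
    case (2 a)
    with \<open>balanced u\<close> show ?thesis
      by (simp add: balanced_iff_excess[of _ a])
  next
    case u: (3 a b w)
    show ?thesis
    proof (cases "a = b")
      case True
      then obtain x y where "u = x @ y" "x \<noteq> []" "y \<noteq> []" "balanced x" "balanced y"
        using balanced_split \<open>balanced u\<close> u by metis
      then show ?thesis
        using append "1.IH" by simp
    next
      case False
      with \<open>balanced u\<close> u have "balanced w"
        by (simp add: balanced_wrap)
      then show ?thesis
        using wrap False "1.IH" u by simp
    qed
  qed
qed

section \<open>The anti-morphism and balanced commutations\<close>

lemma omega_append: "omega (x @ y) = omega y @ omega x"
  by (simp add: omega_def)

text \<open>Reversal exchanges the two distinct end letters and the letter swap restores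
  them.\<close>

lemma omega_wrap: "a \<noteq> b \<Longrightarrow> omega (a # v @ [b]) = a # omega v @ [b]"
  by (cases a; cases b) (simp_all add: omega_def)

lemma balanced_omega:
  assumes "balanced u"
  shows "balanced (omega u)"
  using assms
proof (induction rule: balanced_induct)
  case (append x y)
  then show ?case
    by (simp add: omega_append balanced_iff_excess[of _ D])
qed (simp_all add: omega_def[of "[]"] omega_wrap balanced_wrap)

lemma bal_equiv_refl: "bal_equiv x x"
  unfolding bal_equiv_def by simp

lemma bal_equiv_trans [trans]: "bal_equiv x y \<Longrightarrow> bal_equiv y z \<Longrightarrow> bal_equiv x z"
  unfolding bal_equiv_def by (rule equivclp_trans)

lemma bal_comm_context: "bal_comm x y \<Longrightarrow> bal_comm (p @ x @ q) (p @ y @ q)"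
proof (induction rule: bal_comm.induct)
  case (1 x y p' q')
  then show ?case
    using bal_comm.intros[of x y "p @ p'" "q' @ q"] by simp
qed

lemma bal_equiv_context:
  assumes "bal_equiv x y"
  shows "bal_equiv (p @ x @ q) (p @ y @ q)"
  using assms unfolding bal_equiv_def
proof (induction rule: equivclp_induct)
  case (step y z)
  then show ?case
    \<comment> \<open>A link in the generated equivalence may use \<open>bal_comm\<close> in either
      direction.\<close>
    using bal_comm_context[of y z p q] bal_comm_context[of z y p q]
    by (metis equivclp_into_equivclp)
qed simp

lemma bal_equiv_append:
  assumes "bal_equiv x x'" "bal_equiv y y'"
  shows "bal_equiv (x @ y) (x' @ y')"
  using bal_equiv_context[OF assms(1), of "[]" y] bal_equiv_context[OF assms(2), of x' "[]"]
  by (auto intro: bal_equiv_trans)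

lemma bal_equiv_commute:
  assumes "balanced x" "balanced y"
  shows "bal_equiv (y @ x) (x @ y)"
  using bal_comm.intros[OF assms, of "[]" "[]"] by (auto simp: bal_equiv_def)

lemma bal_equiv_omega:
  assumes "balanced u"
  shows "bal_equiv u (omega u)"
  using assms
proof (induction rule: balanced_induct)
  case Nil
  show ?case by (simp add: omega_def bal_equiv_refl)
next
  case (append x y)
  have "bal_equiv (x @ y) (omega x @ omega y)"
    by (intro bal_equiv_append append.IH)
  also have "bal_equiv (omega x @ omega y) (omega y @ omega x)"
    by (intro bal_equiv_commute balanced_omega append.hyps)
  finally show ?case
    by (simp add: omega_append)
next
  case (wrap a b v)
  then show ?case
    using bal_equiv_context[of v "omega v" "[a]" "[b]"] by (simp add: omega_wrap)
qed

section \<open>Commuting shifts of \<open>weyl_N\<close> in the Weyl algebra\<close>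

abbreviation weyl_N :: "'k::field_char_0 weyl"
  where "weyl_N \<equiv> weyl_gen U * weyl_gen D"

lemma weyl_D_U: "weyl_gen D * weyl_gen U = (weyl_N + 1 :: 'k::field_char_0 weyl)"
  using weyl_relation[where 'k='k] by (simp add: algebra_simps)

text \<open>Products of shifts \<open>N + k\<close> suffice, since wrapping only moves the shifts and adds a factor.\<close>

inductive_set shift_products :: "'k::field_char_0 weyl set"
  where
    one: "1 \<in> shift_products"
  | mult: "f \<in> shift_products \<Longrightarrow> (weyl_N + of_int k) * f \<in> shift_products"

lemma shift_products_mult:
  "f \<in> shift_products \<Longrightarrow> g \<in> shift_products \<Longrightarrow> f * g \<in> shift_products"
  by (induction rule: shift_products.induct) (auto simp: mult.assoc intro: shift_products.mult)

text \<open>Integer constants are central, so expanding both sides gives the same terms.\<close>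

lemma shift_factors_commute:
  "(weyl_N + of_int k) * (weyl_N + of_int l) =
    (weyl_N + of_int l) * (weyl_N + of_int k :: 'k::field_char_0 weyl)"
proof -
  have "of_int k * of_int l = (of_int l * of_int k :: 'k weyl)"
    by (rule mult_of_int_commute)
  moreover have "of_int k * weyl_N = (weyl_N * of_int k :: 'k weyl)" for k
    by (rule mult_of_int_commute)
  ultimately show ?thesis
    by (simp add: distrib_left distrib_right add_ac)
qed

lemma shift_factor_commute:
  assumes "f \<in> shift_products"
  shows "(weyl_N + of_int k) * f = f * (weyl_N + of_int k)"
  using assms
proof (induction rule: shift_products.induct)
  case (mult f l)
  have "(weyl_N + of_int k) * ((weyl_N + of_int l) * f) =
      (weyl_N + of_int l) * ((weyl_N + of_int k) * f)"
    by (simp only: shift_factors_commute[of k l] flip: mult.assoc)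
  also have "\<dots> = (weyl_N + of_int l) * f * (weyl_N + of_int k)"
    by (simp only: mult.IH mult.assoc)
  finally show ?case .
qed simp

lemma shift_products_commute:
  assumes "f \<in> shift_products" "g \<in> shift_products"
  shows "f * g = g * f"
  using assms(1)
proof (induction rule: shift_products.induct)
  case (mult f k)
  have "(weyl_N + of_int k) * f * g = (weyl_N + of_int k) * g * f"
    by (simp only: mult.IH mult.assoc)
  also have "\<dots> = g * ((weyl_N + of_int k) * f)"
    by (simp only: shift_factor_commute[OF assms(2)] mult.assoc)
  finally show ?case .
qed simp

lemma weyl_D_shift:
  "weyl_gen D * (weyl_N + of_int k) = (weyl_N + of_int (k + 1)) * (weyl_gen D :: 'k::field_char_0 weyl)"
proof -
  have "weyl_gen D * (weyl_N + of_int k) =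
      (weyl_gen D * weyl_gen U) * weyl_gen D + weyl_gen D * (of_int k :: 'k weyl)"
    by (simp only: distrib_left mult.assoc)
  also have "\<dots> = (weyl_N + 1) * weyl_gen D + of_int k * weyl_gen D"
    by (simp only: weyl_D_U mult_of_int_commute)
  also have "\<dots> = (weyl_N + of_int (k + 1)) * weyl_gen D"
    by (simp only: distrib_right of_int_add of_int_1 add_ac)
  finally show ?thesis .
qed

lemma weyl_U_shift:
  "weyl_gen U * (weyl_N + of_int k) = (weyl_N + of_int (k - 1)) * (weyl_gen U :: 'k::field_char_0 weyl)"
proof -
  \<comment> \<open>Starting from the right-hand side, regrouping \<open>(U D) U\<close> as
    \<open>U (D U)\<close> makes \<open>weyl_D_U\<close> applicable; its extra 1 cancels the -1 in
    the shift.\<close>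
  have "(weyl_N + of_int (k - 1)) * weyl_gen U =
      weyl_gen U * (weyl_gen D * weyl_gen U) + of_int (k - 1) * (weyl_gen U :: 'k weyl)"
    by (simp only: distrib_right mult.assoc)
  also have "\<dots> = weyl_gen U * (weyl_N + 1) + weyl_gen U * of_int (k - 1)"
    by (simp only: weyl_D_U mult_of_int_commute)
  also have "\<dots> = weyl_gen U * (weyl_N + of_int k)"
    by (simp only: of_int_diff of_int_1 flip: distrib_left) simp
  finally show ?thesis ..
qed

text \<open>The letter passes one factor at a time, raising its constant by 1 for \<open>D\<close>
  and lowering it by 1 for \<open>U\<close>.\<close>

lemma weyl_gen_shift:
  assumes "f \<in> shift_products"
  shows "\<exists>g\<in>shift_products. weyl_gen a * f = g * weyl_gen a"
  using assms
proof (induction rule: shift_products.induct)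
  case one
  show ?case by (intro bexI[of _ 1] shift_products.one) simp
next
  case (mult f k)
  then obtain g where g: "g \<in> shift_products" "weyl_gen a * f = g * weyl_gen a"
    by blast
  obtain l where "weyl_gen a * (weyl_N + of_int k) = (weyl_N + of_int l) * (weyl_gen a :: 'a weyl)"
    by (cases a) (blast intro: weyl_D_shift weyl_U_shift)+
  then have "weyl_gen a * ((weyl_N + of_int k) * f) = (weyl_N + of_int l) * (weyl_gen a * f)"
    by (simp only: flip: mult.assoc)
  also have "\<dots> = ((weyl_N + of_int l) * g) * weyl_gen a"
    by (simp only: g(2) mult.assoc)
  finally have "weyl_gen a * ((weyl_N + of_int k) * f) = ((weyl_N + of_int l) * g) * weyl_gen a" .
  then show ?case
    using g(1) by (blast intro: shift_products.mult)
qed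

lemma weyl_gen_mult_in_shift_products:
  assumes "a \<noteq> b"
  shows "weyl_gen a * weyl_gen b \<in> shift_products"
  \<comment> \<open>\<open>U D\<close> is the factor with shift 0, and \<open>D U\<close> the one
    with shift 1.\<close>
  using assms shift_products.mult[OF shift_products.one, of 0]
    shift_products.mult[OF shift_products.one, of 1]
  by (cases a; cases b) (simp_all add: weyl_D_U)

section \<open>Images of balanced words under \<open>phi\<close>\<close>

lemma phi_append: "phi (x @ y) = phi x * phi y"
  by (simp add: phi_def)

lemma phi_balanced_in_shift_products:
  assumes "balanced u"
  shows "(phi u :: 'k::field_char_0 weyl) \<in> shift_products"
  using assms
proof (induction rule: balanced_induct)
  case Nil
  show ?case by (simp add: phi_def shift_products.one)
next
  case (append x y)
  then show ?case by (simp add: phi_append shift_products_mult)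
next
  case (wrap a b v)
  obtain g :: "'k weyl" where g: "g \<in> shift_products" "weyl_gen a * phi v = g * weyl_gen a"
    using weyl_gen_shift[OF wrap.IH] by blast
  have "phi (a # v @ [b]) = weyl_gen a * phi v * (weyl_gen b :: 'k weyl)"
    by (simp add: phi_def mult.assoc)
  \<comment> \<open>Moving the left letter past \<open>phi v\<close> brings the two wrapping letters
    together.\<close>
  also have "\<dots> = g * (weyl_gen a * weyl_gen b)"
    by (simp add: g(2) mult.assoc)
  finally show ?case
    using g(1) wrap.hyps by (simp add: shift_products_mult weyl_gen_mult_in_shift_products)
qed

lemma phi_bal_comm: "bal_comm v w \<Longrightarrow> (phi v :: 'k::field_char_0 weyl) = phi w"
proof (induction rule: bal_comm.induct)
  case (1 x y p q)
  then have "phi y * phi x = (phi x * phi y :: 'k weyl)"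
    by (intro shift_products_commute phi_balanced_in_shift_products)
  then have "phi p * (phi y * phi x) * phi q = phi p * (phi x * phi y) * (phi q :: 'k weyl)"
    by simp
  then show ?case
    by (simp only: phi_append mult.assoc)
qed

lemma phi_bal_equiv:
  assumes "bal_equiv v w"
  shows "(phi v :: 'k::field_char_0 weyl) = phi w"
  using assms unfolding bal_equiv_def
proof (induction rule: equivclp_induct)
  case (step y z)
  then show ?case
    using phi_bal_comm[of y z, where 'k='k] phi_bal_comm[of z y, where 'k='k] by auto
qed simp

theorem theorem2p3:
  fixes u :: word
  assumes "balanced u"
  shows "(phi u :: 'k::field_char_0 weyl) = phi (omega u) \<and> bal_equiv u (omega u)"
  \<comment> \<open>The equality in the Weyl algebra follows from the equivalence of words, by
    invariance of \<open>phi\<close>.\<close>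
  using bal_equiv_omega[OF assms] by (simp add: phi_bal_equiv)

end
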